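(* The graph $\Gamma_C^Z(\mathbb{S})$ is connected, and its diameter is at most $4$.
   Context: Cayley-Dickson conventions. Let $\mathcal{M}_0=\mathbb{R}$ with trivial involution, and let $\mathcal{M}_{n+1}=\mathcal{M}_n\times\mathcal{M}_n$ with componentwise real vector space structure, product $(a,b)(c,d)=(ac-\bar d b,\ da+b\bar c)$ and involution $\overline{(a,b)}=(\bar a,-b)$. The sedenions are $\mathbb{S}=\mathcal{M}_4$, with center $\mathbb{R}=\mathbb{R}\cdot 1$. The imaginary part of $x$ is $\mathrm{Im}(x)=\frac{x-\bar x}{2}$. $Z(\mathbb{S})$ denotes the set of zero divisors, i.e. nonzero $u\in\mathbb{S}$ for which there is a nonzero $v\in\mathbb{S}$ with $uv=0$ or $vu=0$. The commutativity graph $\Gamma_C(\mathbb{S})$ is the undirected graph whose vertices are the lines $[x]=\mathbb{R}x$ with $x\in\mathbb{S}\setminus\mathbb{R}$, in which distinct vertices $[x],[y]$ are adjacent iff $xy=yx$. Let $\mathbb{R}+Z(\mathbb{S})$ be the set of elements of $\mathbb{S}$ whose imaginary part is a zero divisor. $\Gamma_C^Z(\mathbb{S})$ is the (induced) subgraph of $\Gamma_C(\mathbb{S})$ on the vertex set $\{[x]\mid x\in\mathbb{R}+Z(\mathbb{S})\}$. *)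

theory Defs
  imports "HOL-Analysis.Product_Vector" "Graph_Theory.Graph_Theory"
begin

(* One Cayley-Dickson doubling step: m and j are the multiplication and the involution of the
   algebra being doubled.  They are passed as arguments because a class instance for products
   cannot be restricted to two factors of the same type. *)

definition cd_mult ::
    "('a \<Rightarrow> 'a \<Rightarrow> 'a) \<Rightarrow> ('a \<Rightarrow> 'a) \<Rightarrow> 'a \<times> 'a \<Rightarrow> 'a \<times> 'a \<Rightarrow> 'a::ab_group_add \<times> 'a"
  where "cd_mult m j = (\<lambda>(a, b) (c, d). (m a c - m (j d) b, m d a + m b (j c)))"

definition cd_conj :: "('a \<Rightarrow> 'a) \<Rightarrow> 'a \<times> 'a \<Rightarrow> 'a::ab_group_add \<times> 'a"
  where "cd_conj j = (\<lambda>(a, b). (j a, - b))"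

type_synonym M0 = real
type_synonym M1 = "M0 \<times> M0"
type_synonym M2 = "M1 \<times> M1"
type_synonym M3 = "M2 \<times> M2"
type_synonym M4 = "M3 \<times> M3"

definition conj0 :: "M0 \<Rightarrow> M0" where "conj0 = id"
definition conj1 :: "M1 \<Rightarrow> M1" where "conj1 = cd_conj conj0"
definition conj2 :: "M2 \<Rightarrow> M2" where "conj2 = cd_conj conj1"
definition conj3 :: "M3 \<Rightarrow> M3" where "conj3 = cd_conj conj2"
definition conj4 :: "M4 \<Rightarrow> M4" where "conj4 = cd_conj conj3"

definition mult0 :: "M0 \<Rightarrow> M0 \<Rightarrow> M0" where "mult0 = (*)"
definition mult1 :: "M1 \<Rightarrow> M1 \<Rightarrow> M1" where "mult1 = cd_mult mult0 conj0"
definition mult2 :: "M2 \<Rightarrow> M2 \<Rightarrow> M2" where "mult2 = cd_mult mult1 conj1"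
definition mult3 :: "M3 \<Rightarrow> M3 \<Rightarrow> M3" where "mult3 = cd_mult mult2 conj2"
definition mult4 :: "M4 \<Rightarrow> M4 \<Rightarrow> M4" where "mult4 = cd_mult mult3 conj3"

type_synonym sedenion = M4

abbreviation sed_mult :: "sedenion \<Rightarrow> sedenion \<Rightarrow> sedenion" (infixl "\<otimes>\<^sub>S" 70)
  where "x \<otimes>\<^sub>S y \<equiv> mult4 x y"

definition sed_one :: sedenion where "sed_one = ((((1, 0), 0), 0), 0)"

definition sed_Reals :: "sedenion set" where "sed_Reals = range (\<lambda>r. r *\<^sub>R sed_one)"

definition sed_Im :: "sedenion \<Rightarrow> sedenion" where "sed_Im x = (x - conj4 x) /\<^sub>R 2"

definition sed_zero_divisors :: "sedenion set"
  where "sed_zero_divisors =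
    {u. u \<noteq> 0 \<and> (\<exists>v. v \<noteq> 0 \<and> (u \<otimes>\<^sub>S v = 0 \<or> v \<otimes>\<^sub>S u = 0))}"

definition sed_Reals_plus_Z :: "sedenion set"
  where "sed_Reals_plus_Z = {x. sed_Im x \<in> sed_zero_divisors}"

definition sed_line :: "sedenion \<Rightarrow> sedenion set" where "sed_line x = span {x}"

(* An undirected graph is represented, as usual in Graph_Theory, by a symmetric digraph. *)

definition sed_comm_graph :: "sedenion set pair_pre_digraph"
  where "sed_comm_graph =
    \<lparr> pverts = sed_line ` (- sed_Reals),
      parcs = {(sed_line x, sed_line y) | x y.
        x \<notin> sed_Reals \<and> y \<notin> sed_Reals \<and> sed_line x \<noteq> sed_line y \<and> x \<otimes>\<^sub>S y = y \<otimes>\<^sub>S x} \<rparr>"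

definition sed_comm_graph_Z :: "(sedenion set, sedenion set \<times> sedenion set) pre_digraph"
  where "sed_comm_graph_Z = with_proj sed_comm_graph \<restriction> (sed_line ` sed_Reals_plus_Z)"

(* The distance of two vertices is the infimum of the lengths of the walks between them, i.e. the
   shortest-path cost for unit weights; it is \<infinity> if there is no walk. *)

definition diameter :: "('v, 'e) pre_digraph \<Rightarrow> ereal"
  where "diameter G = (SUP u\<in>verts G. SUP v\<in>verts G. wf_digraph.\<mu> G (\<lambda>_. 1) u v)"


lemma sed_one_left: "sed_one \<otimes>\<^sub>S x = x"
  and sed_one_right: "x \<otimes>\<^sub>S sed_one = x"
  by (cases x; auto simp: sed_one_def mult4_def mult3_def mult2_def mult1_def mult0_def cd_mult_def
      conj3_def conj2_def conj1_def conj0_def cd_conj_def zero_prod_def)+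

lemma sed_mult_scaleR_left: "(r *\<^sub>R x) \<otimes>\<^sub>S y = r *\<^sub>R (x \<otimes>\<^sub>S y)"
  and sed_mult_scaleR_right: "x \<otimes>\<^sub>S (r *\<^sub>R y) = r *\<^sub>R (x \<otimes>\<^sub>S y)"
  by (cases x; cases y; auto simp: mult4_def mult3_def mult2_def mult1_def mult0_def cd_mult_def
      conj3_def conj2_def conj1_def conj0_def cd_conj_def zero_prod_def algebra_simps)+

lemma sed_line_eqE:
  assumes "sed_line x = sed_line x'"
  obtains r where "x' = r *\<^sub>R x"
proof -
  have "x' \<in> span {x}" using assms span_base[of x' "{x'}"] by (simp add: sed_line_def)
  then show thesis using that by (auto simp: span_singleton)
qed

(* Commutation depends only on the lines, so adjacency is independent of representatives. *)

lemma sed_comm_graph_adj_iff: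
  assumes "x \<notin> sed_Reals" "y \<notin> sed_Reals"
  shows "(sed_line x, sed_line y) \<in> parcs sed_comm_graph \<longleftrightarrow>
    sed_line x \<noteq> sed_line y \<and> x \<otimes>\<^sub>S y = y \<otimes>\<^sub>S x"
proof
  assume "(sed_line x, sed_line y) \<in> parcs sed_comm_graph"
  then obtain x' y' where *: "sed_line x = sed_line x'" "sed_line y = sed_line y'"
      "sed_line x \<noteq> sed_line y" "x' \<otimes>\<^sub>S y' = y' \<otimes>\<^sub>S x'"
    unfolding sed_comm_graph_def pair_pre_digraph.select_convs mem_Collect_eq prod.inject by blast
  obtain r where "x = r *\<^sub>R x'" using sed_line_eqE *(1) by metis
  moreover obtain s where "y = s *\<^sub>R y'" using sed_line_eqE *(2) by metis
  ultimately show "sed_line x \<noteq> sed_line y \<and> x \<otimes>\<^sub>S y = y \<otimes>\<^sub>S x"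
    using *(3,4) by (simp add: sed_mult_scaleR_left sed_mult_scaleR_right mult.commute)
next
  assume "sed_line x \<noteq> sed_line y \<and> x \<otimes>\<^sub>S y = y \<otimes>\<^sub>S x"
  then show "(sed_line x, sed_line y) \<in> parcs sed_comm_graph"
    unfolding sed_comm_graph_def pair_pre_digraph.select_convs mem_Collect_eq using assms by blast
qed

lemma sed_Im_Reals: "x \<in> sed_Reals \<Longrightarrow> sed_Im x = 0"
  by (auto simp: sed_Reals_def sed_Im_def sed_one_def conj4_def conj3_def conj2_def conj1_def
      conj0_def cd_conj_def zero_prod_def)

lemma sed_Reals_plus_Z_nonreal: "sed_Reals_plus_Z \<subseteq> - sed_Reals"
  using sed_Im_Reals by (auto simp: sed_Reals_plus_Z_def sed_zero_divisors_def)

lemma sed_comm_graph_arcE: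
  assumes "e \<in> parcs sed_comm_graph"
  obtains x y where "e = (sed_line x, sed_line y)" "x \<notin> sed_Reals" "y \<notin> sed_Reals"
    "sed_line x \<noteq> sed_line y" "x \<otimes>\<^sub>S y = y \<otimes>\<^sub>S x"
  using assms unfolding sed_comm_graph_def pair_pre_digraph.select_convs mem_Collect_eq by blast

lemma pverts_sed_comm_graph: "pverts sed_comm_graph = sed_line ` (- sed_Reals)"
  by (simp add: sed_comm_graph_def)

lemma pair_bidirected_sed_comm_graph: "pair_bidirected_digraph sed_comm_graph"
proof
  fix e assume "e \<in> parcs sed_comm_graph"
  then obtain x y where "e = (sed_line x, sed_line y)" "x \<notin> sed_Reals" "y \<notin> sed_Reals"
      "sed_line x \<noteq> sed_line y"
    by (rule sed_comm_graph_arcE)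
  then show "fst e \<in> pverts sed_comm_graph" "snd e \<in> pverts sed_comm_graph" "fst e \<noteq> snd e"
    by (simp_all add: pverts_sed_comm_graph)
next
  show "symmetric (with_proj sed_comm_graph)"
    unfolding symmetric_def with_proj_simps
  proof (rule symI)
    fix u v assume "(u, v) \<in> parcs sed_comm_graph"
    then obtain x y where *: "(u, v) = (sed_line x, sed_line y)" "x \<notin> sed_Reals"
        "y \<notin> sed_Reals" "sed_line x \<noteq> sed_line y" "x \<otimes>\<^sub>S y = y \<otimes>\<^sub>S x"
      by (rule sed_comm_graph_arcE)
    then have "(sed_line y, sed_line x) \<in> parcs sed_comm_graph"
      by (subst sed_comm_graph_adj_iff) simp_all
    with *(1) show "(v, u) \<in> parcs sed_comm_graph" by simp
  qed
qed

lemma induced_sed_comm_graph_Z: "induced_subgraph sed_comm_graph_Z (with_proj sed_comm_graph)"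
proof -
  interpret pair_bidirected_digraph sed_comm_graph by (rule pair_bidirected_sed_comm_graph)
  show ?thesis unfolding sed_comm_graph_Z_def
    by (rule induced_induce)
      (simp add: pverts_sed_comm_graph image_mono sed_Reals_plus_Z_nonreal)
qed

end

theory Submission
  imports Defs "HOL-Analysis.Linear_Algebra"
begin

text \<open>
  A sedenion is a pair of octonions \<open>(a, b)\<close>. The zero divisors with vanishing real part are the
  pairs of purely imaginary, orthogonal octonions of the same nonzero length
  (\<open>zero_divisor_imp_null_pair\<close>, \<open>null_pair_imp_zero_divisor\<close>). Read \<open>(a, b)\<close> as the element
  \<open>U = a + ib\<close> of the complexified octonions \<open>\<complex> \<otimes> \<O>\<close>: these pairs are exactly the nonzero imaginary
  \<open>U\<close> that are isotropic for the complex bilinear form, that is, null vectors in \<open>\<complex>\<^sup>7\<close>.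

  Commuting in the sedenions becomes a condition in complex geometry: two null vectors \<open>U\<close> and \<open>W\<close>
  commute as sedenions if \<open>UW = 0\<close> in \<open>\<complex> \<otimes> \<O>\<close> and the Hermitian product of \<open>U\<close> and \<open>W\<close> is real
  (\<open>real_collinear_imp_commute\<close>). The complex lines of null vectors, with the relation \<open>UW = 0\<close> as
  collinearity, are the points of the split Cayley hexagon over \<open>\<complex>\<close>, a generalized hexagon. Its
  points have distance at most 3, so any two null vectors are joined by a path
  \<open>U, P, Q, V\<close> whose consecutive products vanish. It remains to make the three Hermitian products
  real, and this is what costs the additional fourth step.

  The path is explicit. If \<open>UP = 0\<close> and \<open>P\<close> is orthogonal to \<open>V\<close> for the bilinear form, then
  \<open>Q = PV\<close> is imaginary and null, and \<open>PQ = P(PV) = 0\<close> and \<open>QV = (PV)V = 0\<close> by the alternative laws,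
  since the squares of \<open>P\<close> and \<open>V\<close> are zero (\<open>bioct_mult_null_pair\<close>). The vectors \<open>P\<close> with \<open>UP = 0\<close>
  that are Hermitian orthogonal to \<open>U\<close> are parametrized by an imaginary octonion \<open>c\<close> orthogonal to
  \<open>a\<close>, \<open>b\<close> and \<open>ab\<close> (\<open>annihilator_of_null_pair\<close>). Orthogonality of \<open>P\<close> to \<open>V\<close> is two more real linear
  conditions on \<open>c\<close>, and reality of the Hermitian product of \<open>Q\<close> and \<open>V\<close> is one more. These are
  seven conditions in dimension eight, so a nonzero \<open>c\<close> exists (\<open>real_collinear_path\<close>). Nothing
  makes the Hermitian product of \<open>P\<close> and \<open>Q\<close> real, but the component \<open>R\<close> of \<open>Q\<close> orthogonal to \<open>P\<close>
  lies on the same line of the hexagon and has a real Hermitian product with both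
  (\<open>real_collinear_midpoint\<close>). Hence \<open>U, P, R, Q, V\<close> is a path of length at most 4.

  Finally, adding real multiples of the unit does not affect commutation
  (\<open>commute_if_Im_commute\<close>), so it suffices to join the imaginary parts of two given elements.
\<close>

section \<open>Octonions\<close>

abbreviation oct_mult :: "M3 \<Rightarrow> M3 \<Rightarrow> M3" (infixl "\<otimes>\<^sub>O" 70)
  where "x \<otimes>\<^sub>O y \<equiv> mult3 x y"

definition oct_one :: M3 where "oct_one = (((1, 0), 0), 0)"

definition oct_pure :: "M3 \<Rightarrow> bool" where "oct_pure x \<longleftrightarrow> x \<bullet> oct_one = 0"

lemmas oct_coords = mult3_def mult2_def mult1_def mult0_def cd_mult_def
  conj3_def conj2_def conj1_def conj0_def cd_conj_def oct_one_def zero_prod_def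

lemma bilinear_oct_mult: "bilinear mult3"
proof -
  have "\<And>x y z. x \<otimes>\<^sub>O (y + z) = x \<otimes>\<^sub>O y + x \<otimes>\<^sub>O z"
    and "\<And>x y z. (y + z) \<otimes>\<^sub>O x = y \<otimes>\<^sub>O x + z \<otimes>\<^sub>O x"
    and "\<And>r x y. x \<otimes>\<^sub>O (r *\<^sub>R y) = r *\<^sub>R (x \<otimes>\<^sub>O y)"
    and "\<And>r x y. (r *\<^sub>R x) \<otimes>\<^sub>O y = r *\<^sub>R (x \<otimes>\<^sub>O y)"
    unfolding split_paired_all by (simp_all add: oct_coords algebra_simps)
  then show ?thesis by (auto simp: bilinear_def intro!: linearI)
qed

interpretation oct: bounded_bilinear mult3
  using bilinear_oct_mult by (simp add: bilinear_conv_bounded_bilinear)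

lemmas oct_bilinear = oct.add_left oct.add_right oct.diff_left oct.diff_right
  oct.minus_left oct.minus_right oct.scaleR_left oct.scaleR_right oct.zero_left oct.zero_right

lemma oct_one_mult: "oct_one \<otimes>\<^sub>O x = x" and oct_mult_one: "x \<otimes>\<^sub>O oct_one = x"
  by (cases x; auto simp: oct_coords)+

lemma oct_conj_eq: "conj3 x = (2 * (x \<bullet> oct_one)) *\<^sub>R oct_one - x"
  by (cases x; auto simp: oct_coords)

text \<open>The two adjoint laws and the two alternative laws are the only properties of octonions that
  are checked in coordinates beyond bilinearity, unit and conjugation. Multiplicativity of the norm
  and the calculus of imaginary octonions follow from them.\<close>
lemma oct_left_adjoint: "(x \<otimes>\<^sub>O y) \<bullet> z = y \<bullet> (conj3 x \<otimes>\<^sub>O z)"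
proof -
  have "\<And>x y z. (x \<otimes>\<^sub>O y) \<bullet> z = y \<bullet> (conj3 x \<otimes>\<^sub>O z)"
    unfolding split_paired_all by (simp add: oct_coords algebra_simps)
  then show ?thesis .
qed

lemma oct_right_adjoint: "(y \<otimes>\<^sub>O x) \<bullet> z = y \<bullet> (z \<otimes>\<^sub>O conj3 x)"
proof -
  have "\<And>x y z. (y \<otimes>\<^sub>O x) \<bullet> z = y \<bullet> (z \<otimes>\<^sub>O conj3 x)"
    unfolding split_paired_all by (simp add: oct_coords algebra_simps)
  then show ?thesis .
qed

lemma oct_left_alternative: "conj3 x \<otimes>\<^sub>O (x \<otimes>\<^sub>O y) = (x \<bullet> x) *\<^sub>R y"
proof -
  have "\<And>x y. conj3 x \<otimes>\<^sub>O (x \<otimes>\<^sub>O y) = (x \<bullet> x) *\<^sub>R y"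
    unfolding split_paired_all by (simp add: oct_coords algebra_simps)
  then show ?thesis .
qed

lemma oct_right_alternative: "(y \<otimes>\<^sub>O x) \<otimes>\<^sub>O conj3 x = (x \<bullet> x) *\<^sub>R y"
proof -
  have "\<And>x y. (y \<otimes>\<^sub>O x) \<otimes>\<^sub>O conj3 x = (x \<bullet> x) *\<^sub>R y"
    unfolding split_paired_all by (simp add: oct_coords algebra_simps)
  then show ?thesis .
qed

lemma oct_comp_left: "(x \<otimes>\<^sub>O y) \<bullet> (x \<otimes>\<^sub>O z) = (x \<bullet> x) * (y \<bullet> z)"
  by (simp add: oct_left_adjoint oct_left_alternative)

lemma oct_comp_right: "(y \<otimes>\<^sub>O x) \<bullet> (z \<otimes>\<^sub>O x) = (x \<bullet> x) * (y \<bullet> z)"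
  by (simp add: oct_right_adjoint oct_right_alternative)

text \<open>Polarization of \<open>oct_comp_left\<close> in its left factor \<open>x\<close>.\<close>
lemma oct_comp_polar:
  "(x \<otimes>\<^sub>O y) \<bullet> (z \<otimes>\<^sub>O w) + (z \<otimes>\<^sub>O y) \<bullet> (x \<otimes>\<^sub>O w) = 2 * (x \<bullet> z) * (y \<bullet> w)"
  using oct_comp_left[of "x + z" y w] oct_comp_left[of x y w] oct_comp_left[of z y w]
  by (simp add: oct_bilinear inner_add_left inner_add_right inner_commute algebra_simps)

lemma pure_conj: "oct_pure a \<Longrightarrow> conj3 a = - a"
  by (simp add: oct_conj_eq oct_pure_def)

lemma pure_left_adjoint: "oct_pure a \<Longrightarrow> (a \<otimes>\<^sub>O y) \<bullet> z = - (y \<bullet> (a \<otimes>\<^sub>O z))"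
  by (simp add: oct_left_adjoint pure_conj oct_bilinear)

lemma pure_right_adjoint: "oct_pure a \<Longrightarrow> (y \<otimes>\<^sub>O a) \<bullet> z = - (y \<bullet> (z \<otimes>\<^sub>O a))"
  by (simp add: oct_right_adjoint pure_conj oct_bilinear)

lemma pure_left_square: "oct_pure a \<Longrightarrow> a \<otimes>\<^sub>O (a \<otimes>\<^sub>O y) = - ((a \<bullet> a) *\<^sub>R y)"
  using oct_left_alternative[of a y] by (simp add: pure_conj oct_bilinear) (metis minus_minus)

lemma pure_right_square: "oct_pure a \<Longrightarrow> (y \<otimes>\<^sub>O a) \<otimes>\<^sub>O a = - ((a \<bullet> a) *\<^sub>R y)"
  using oct_right_alternative[of y a] by (simp add: pure_conj oct_bilinear) (metis minus_minus)

lemma pure_add: "oct_pure a \<Longrightarrow> oct_pure b \<Longrightarrow> oct_pure (a + b)"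
  and pure_diff: "oct_pure a \<Longrightarrow> oct_pure b \<Longrightarrow> oct_pure (a - b)"
  and pure_scaleR: "oct_pure a \<Longrightarrow> oct_pure (r *\<^sub>R a)"
  by (simp_all add: oct_pure_def inner_add_left inner_diff_left)

lemma inner_square_sum_scaleR:
  "((a + b) \<bullet> (a + b)) *\<^sub>R y = (a \<bullet> a) *\<^sub>R y + (2 * (a \<bullet> b)) *\<^sub>R y + (b \<bullet> b) *\<^sub>R y"
  for a b :: "'a::real_inner" and y :: "'b::real_vector"
proof -
  have "(a + b) \<bullet> (a + b) = a \<bullet> a + 2 * (a \<bullet> b) + b \<bullet> b"
    by (simp add: inner_add_left inner_add_right inner_commute)
  then show ?thesis by (simp only: scaleR_add_left)
qed

text \<open>For imaginary octonions the alternative law says that left multiplication by \<open>a\<close> squares to a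
  negative scalar. Polarizing gives the Clifford relation; in particular left multiplications by
  orthogonal imaginary octonions anticommute. The same holds on the right.\<close>
lemma pure_left_swap:
  assumes "oct_pure a" "oct_pure b"
  shows "a \<otimes>\<^sub>O (b \<otimes>\<^sub>O y) = - (b \<otimes>\<^sub>O (a \<otimes>\<^sub>O y)) - (2 * (a \<bullet> b)) *\<^sub>R y"
proof -
  have "(a + b) \<otimes>\<^sub>O ((a + b) \<otimes>\<^sub>O y) = - (((a + b) \<bullet> (a + b)) *\<^sub>R y)"
    using assms by (simp add: pure_left_square pure_add)
  then have "a \<otimes>\<^sub>O (b \<otimes>\<^sub>O y) + (b \<otimes>\<^sub>O (a \<otimes>\<^sub>O y) + (2 * (a \<bullet> b)) *\<^sub>R y) = 0"
    using assms unfolding inner_square_sum_scaleR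
    by (simp add: oct_bilinear pure_left_square algebra_simps)
  then show ?thesis by (simp add: add_eq_0_iff2)
qed

lemma pure_right_swap:
  assumes "oct_pure a" "oct_pure b"
  shows "(y \<otimes>\<^sub>O a) \<otimes>\<^sub>O b = - ((y \<otimes>\<^sub>O b) \<otimes>\<^sub>O a) - (2 * (a \<bullet> b)) *\<^sub>R y"
proof -
  have "(y \<otimes>\<^sub>O (a + b)) \<otimes>\<^sub>O (a + b) = - (((a + b) \<bullet> (a + b)) *\<^sub>R y)"
    using assms by (simp add: pure_right_square pure_add)
  then have "(y \<otimes>\<^sub>O a) \<otimes>\<^sub>O b + ((y \<otimes>\<^sub>O b) \<otimes>\<^sub>O a + (2 * (a \<bullet> b)) *\<^sub>R y) = 0"
    using assms unfolding inner_square_sum_scaleR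
    by (simp add: oct_bilinear pure_right_square algebra_simps)
  then show ?thesis by (simp add: add_eq_0_iff2)
qed

lemma pure_self_mult: "oct_pure a \<Longrightarrow> a \<otimes>\<^sub>O a = - ((a \<bullet> a) *\<^sub>R oct_one)"
  using pure_left_square[of a oct_one] by (simp add: oct_mult_one)

lemma pure_mult_commute:
  assumes "oct_pure a" "oct_pure b"
  shows "a \<otimes>\<^sub>O b = - (b \<otimes>\<^sub>O a) - (2 * (a \<bullet> b)) *\<^sub>R oct_one"
  using pure_left_swap[OF assms, of oct_one] by (simp add: oct_mult_one)

lemma pure_mult_Re: "oct_pure a \<Longrightarrow> (a \<otimes>\<^sub>O b) \<bullet> oct_one = - (a \<bullet> b)"
  by (simp add: pure_left_adjoint oct_mult_one) (simp add: inner_commute)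

section \<open>Null vectors in the complexified octonions\<close>

fun null_pair :: "M4 \<Rightarrow> bool"
  where "null_pair (a, b) \<longleftrightarrow> oct_pure a \<and> oct_pure b \<and> a \<noteq> 0 \<and> a \<bullet> b = 0 \<and> a \<bullet> a = b \<bullet> b"

text \<open>The product of \<open>a + ib\<close> and \<open>c + id\<close> in \<open>\<complex> \<otimes> \<O>\<close>, on the same pairs as the sedenions. It
  differs from the Cayley-Dickson product: scalars \<open>i\<close> commute and associate with everything, so
  the alternative laws survive.\<close>
fun bioct_mult :: "M4 \<Rightarrow> M4 \<Rightarrow> M4" (infixl "\<otimes>\<^sub>B" 70)
  where "(a, b) \<otimes>\<^sub>B (c, d) = (a \<otimes>\<^sub>O c - b \<otimes>\<^sub>O d, a \<otimes>\<^sub>O d + b \<otimes>\<^sub>O c)"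

text \<open>The second condition says that the Hermitian product of \<open>u = a + ib\<close> and \<open>w = c + id\<close> is
  real. Its imaginary part is \<open>a \<bullet> d - b \<bullet> c\<close>, and for imaginary pairs with vanishing product
  \<open>b \<bullet> c = - (a \<bullet> d)\<close>.\<close>
definition real_collinear :: "M4 \<Rightarrow> M4 \<Rightarrow> bool"
  where "real_collinear u w \<longleftrightarrow> u \<otimes>\<^sub>B w = 0 \<and> fst u \<bullet> snd w = 0"

lemma pair_eq_0_iff: "(x, y) = 0 \<longleftrightarrow> x = 0 \<and> y = 0"
  by (simp add: prod_eq_iff)

lemma null_pairD:
  assumes "null_pair (a, b)"
  shows "oct_pure a" "oct_pure b" "a \<noteq> 0" "a \<bullet> b = 0" "b \<bullet> a = 0" "b \<bullet> b = a \<bullet> a"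
  using assms by (simp_all add: inner_commute)

lemma bioct_mult_eq_0_iff:
  "(a, b) \<otimes>\<^sub>B (c, d) = 0 \<longleftrightarrow> a \<otimes>\<^sub>O c = b \<otimes>\<^sub>O d \<and> a \<otimes>\<^sub>O d = - (b \<otimes>\<^sub>O c)"
  by (simp add: pair_eq_0_iff eq_neg_iff_add_eq_0)

lemma bioct_mult_0D:
  assumes "(a, b) \<otimes>\<^sub>B (c, d) = 0"
  shows "a \<otimes>\<^sub>O c = b \<otimes>\<^sub>O d" "a \<otimes>\<^sub>O d = - (b \<otimes>\<^sub>O c)"
  using assms by (simp_all only: bioct_mult_eq_0_iff)

text \<open>The real parts of the equations in \<open>bioct_mult_0D\<close>: a vanishing product forces orthogonality
  for the complex bilinear form.\<close>
lemma bioct_mult_0_inner: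
  assumes "oct_pure a" "oct_pure b" "(a, b) \<otimes>\<^sub>B (c, d) = 0"
  shows "a \<bullet> c = b \<bullet> d" "a \<bullet> d = - (b \<bullet> c)"
proof -
  note z = bioct_mult_0D[OF assms(3)]
  have "(a \<otimes>\<^sub>O c) \<bullet> oct_one = (b \<otimes>\<^sub>O d) \<bullet> oct_one" by (simp only: z(1))
  then show "a \<bullet> c = b \<bullet> d" by (simp only: pure_mult_Re assms(1,2))
  have "(a \<otimes>\<^sub>O d) \<bullet> oct_one = - ((b \<otimes>\<^sub>O c) \<bullet> oct_one)"
    by (simp only: z(2) inner_minus_left)
  then show "a \<bullet> d = - (b \<bullet> c)" by (simp only: pure_mult_Re assms(1,2) neg_equal_iff_equal)
qed

lemma sed_mult_pair: "(a, b) \<otimes>\<^sub>S (c, d) = (a \<otimes>\<^sub>O c - conj3 d \<otimes>\<^sub>O b, d \<otimes>\<^sub>O a + b \<otimes>\<^sub>O conj3 c)"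
  by (simp add: mult4_def cd_mult_def)

lemma sed_mult_pure:
  assumes "oct_pure c" "oct_pure d"
  shows "(a, b) \<otimes>\<^sub>S (c, d) = (a \<otimes>\<^sub>O c + d \<otimes>\<^sub>O b, d \<otimes>\<^sub>O a - b \<otimes>\<^sub>O c)"
  using assms by (simp add: sed_mult_pair pure_conj oct_bilinear)

text \<open>Imaginary elements that are orthogonal for the bilinear form anticommute.\<close>
lemma bioct_mult_0_swap:
  assumes "oct_pure a" "oct_pure b" "oct_pure c" "oct_pure d" "(a, b) \<otimes>\<^sub>B (c, d) = 0"
  shows "(c, d) \<otimes>\<^sub>B (a, b) = 0"
proof -
  note h = bioct_mult_0_inner[OF assms(1,2,5)]
  note z = bioct_mult_0D[OF assms(5)]
  have "c \<otimes>\<^sub>O a = d \<otimes>\<^sub>O b" "c \<otimes>\<^sub>O b = - (d \<otimes>\<^sub>O a)"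
    unfolding pure_mult_commute[OF assms(3,1)] pure_mult_commute[OF assms(4,2)]
      pure_mult_commute[OF assms(3,2)] pure_mult_commute[OF assms(4,1)]
    using h by (simp_all add: z inner_commute)
  then show ?thesis by (simp only: bioct_mult_eq_0_iff)
qed

lemma real_collinearI:
  "(a, b) \<otimes>\<^sub>B (c, d) = 0 \<Longrightarrow> a \<bullet> d = 0 \<Longrightarrow> real_collinear (a, b) (c, d)"
  by (simp only: real_collinear_def fst_conv snd_conv)

lemma real_collinearD:
  assumes "real_collinear (a, b) (c, d)"
  shows "(a, b) \<otimes>\<^sub>B (c, d) = 0" "a \<bullet> d = 0"
  using assms by (simp_all only: real_collinear_def fst_conv snd_conv)

lemma real_collinear_sym:
  assumes "null_pair (a, b)" "null_pair (c, d)" "real_collinear (a, b) (c, d)"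
  shows "real_collinear (c, d) (a, b)"
proof -
  note p = null_pairD(1,2)[OF assms(1)] null_pairD(1,2)[OF assms(2)]
  note z = real_collinearD[OF assms(3)]
  have "c \<bullet> b = 0"
    using bioct_mult_0_inner(2)[OF p(1,2) z(1)] z(2) by (simp add: inner_commute)
  then show ?thesis by (rule real_collinearI[OF bioct_mult_0_swap[OF p z(1)]])
qed

text \<open>In the commutator of imaginary sedenions the first component is a combination of the two
  equations \<open>a \<otimes>\<^sub>O c = b \<otimes>\<^sub>O d\<close> and \<open>c \<otimes>\<^sub>O a = d \<otimes>\<^sub>O b\<close>. The second one is
  \<open>2 (d \<otimes>\<^sub>O a - b \<otimes>\<^sub>O c)\<close>, which the vanishing of the product reduces to a multiple of \<open>a \<bullet> d\<close>.\<close>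
lemma real_collinear_imp_commute:
  assumes "null_pair (a, b)" "null_pair (c, d)" "real_collinear (a, b) (c, d)"
  shows "(a, b) \<otimes>\<^sub>S (c, d) = (c, d) \<otimes>\<^sub>S (a, b)"
proof -
  note p = null_pairD(1,2)[OF assms(1)] null_pairD(1,2)[OF assms(2)]
  note z = bioct_mult_0D[OF real_collinearD(1)[OF assms(3)]]
  note z' = bioct_mult_0D[OF real_collinearD(1)[OF real_collinear_sym[OF assms]]]
  have "d \<otimes>\<^sub>O a = b \<otimes>\<^sub>O c"
    unfolding pure_mult_commute[OF p(4,1)]
    using z(2) real_collinearD(2)[OF assms(3)] by (simp add: inner_commute)
  then have "a \<otimes>\<^sub>O c + d \<otimes>\<^sub>O b = c \<otimes>\<^sub>O a + b \<otimes>\<^sub>O d"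
    and "d \<otimes>\<^sub>O a - b \<otimes>\<^sub>O c = b \<otimes>\<^sub>O c - d \<otimes>\<^sub>O a"
    by (simp_all only: z(1) z'(1) add.commute)
  then show ?thesis by (simp only: sed_mult_pure[OF p(3,4)] sed_mult_pure[OF p(1,2)])
qed

lemma null_pair_anticommute:
  assumes "null_pair (a, b)"
  shows "b \<otimes>\<^sub>O a = - (a \<otimes>\<^sub>O b)"
  using pure_mult_commute[of b a] null_pairD[OF assms] by simp

text \<open>Let \<open>n = a \<bullet> a = b \<bullet> b\<close>. As \<open>b\<close> is invertible, a solution \<open>(p, q)\<close> of the equation
  \<open>a \<otimes>\<^sub>O p = b \<otimes>\<^sub>O q\<close> is determined by \<open>p\<close>; for \<open>p = n c\<close> it is \<open>q = - b \<otimes>\<^sub>O (a \<otimes>\<^sub>O c)\<close>, which is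
  \<open>a \<otimes>\<^sub>O (b \<otimes>\<^sub>O c)\<close> because \<open>a\<close> and \<open>b\<close> are orthogonal. The conditions on \<open>c\<close> say that it is
  orthogonal to the quaternion subalgebra generated by \<open>a\<close> and \<open>b\<close>; they make \<open>(p, q)\<close> imaginary and
  Hermitian orthogonal to \<open>(a, b)\<close>. In this case the sedenion product vanishes along with the product
  in \<open>\<complex> \<otimes> \<O>\<close>, so every null vector is a zero divisor.\<close>
lemma annihilator_of_null_pair:
  assumes ab: "null_pair (a, b)" and "c \<noteq> 0"
    and c: "c \<bullet> oct_one = 0" "c \<bullet> a = 0" "c \<bullet> b = 0" "c \<bullet> (a \<otimes>\<^sub>O b) = 0"
  defines "p \<equiv> (a \<bullet> a) *\<^sub>R c" and "q \<equiv> a \<otimes>\<^sub>O (b \<otimes>\<^sub>O c)"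
  shows "null_pair (p, q)" "(a, b) \<otimes>\<^sub>B (p, q) = 0"
    "a \<bullet> q = 0" "b \<bullet> q = 0" "(a, b) \<otimes>\<^sub>S (p, q) = 0"
proof -
  have pure: "oct_pure a" "oct_pure b" "oct_pure c" and ne: "a \<bullet> a \<noteq> 0"
    and orth: "a \<bullet> b = 0" and len: "b \<bullet> b = a \<bullet> a"
    using ab c by (auto simp: oct_pure_def)
  have swap: "b \<otimes>\<^sub>O (a \<otimes>\<^sub>O x) = - (a \<otimes>\<^sub>O (b \<otimes>\<^sub>O x))" for x
    using pure_left_swap[OF pure(2,1)] orth by (simp add: inner_commute)
  have ba: "b \<otimes>\<^sub>O a = - (a \<otimes>\<^sub>O b)"
    using pure_mult_commute[OF pure(2,1)] orth by (simp add: inner_commute)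
  have bq: "b \<otimes>\<^sub>O q = (a \<bullet> a) *\<^sub>R (a \<otimes>\<^sub>O c)"
    using pure by (simp add: q_def swap pure_left_square len oct_bilinear)
  have aq: "a \<otimes>\<^sub>O q = - ((a \<bullet> a) *\<^sub>R (b \<otimes>\<^sub>O c))"
    using pure by (simp add: q_def pure_left_square)
  have bc0: "(b \<otimes>\<^sub>O c) \<bullet> oct_one = 0"
    using pure_mult_Re[OF pure(2), of c] c by (simp add: inner_commute)
  show a_q: "a \<bullet> q = 0"
  proof -
    have "a \<bullet> q = - ((a \<otimes>\<^sub>O a) \<bullet> (b \<otimes>\<^sub>O c))" using pure by (simp add: q_def pure_left_adjoint)
    also have "a \<otimes>\<^sub>O a = - ((a \<bullet> a) *\<^sub>R oct_one)" by (rule pure_self_mult[OF pure(1)])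
    finally show ?thesis using bc0 by (simp add: inner_commute)
  qed
  show b_q: "b \<bullet> q = 0"
  proof -
    have "b \<bullet> q = - ((a \<otimes>\<^sub>O b) \<bullet> (b \<otimes>\<^sub>O c))" using pure by (simp add: q_def pure_left_adjoint)
    also have "\<dots> = (b \<otimes>\<^sub>O a) \<bullet> (b \<otimes>\<^sub>O c)" by (simp add: ba)
    finally show ?thesis using c by (simp add: oct_comp_left inner_commute)
  qed
  have q0: "oct_pure q"
  proof -
    have "q \<bullet> oct_one = - ((b \<otimes>\<^sub>O c) \<bullet> a)"
      using pure by (simp add: q_def pure_left_adjoint oct_mult_one)
    also have "\<dots> = c \<bullet> (b \<otimes>\<^sub>O a)" using pure by (simp add: pure_left_adjoint)
    finally show ?thesis using c by (simp add: ba oct_pure_def)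
  qed
  have "c \<bullet> q = - ((a \<otimes>\<^sub>O c) \<bullet> (b \<otimes>\<^sub>O c))" using pure by (simp add: q_def pure_left_adjoint)
  then have "p \<bullet> q = 0" by (simp add: p_def oct_comp_right orth)
  moreover have "p \<bullet> p = q \<bullet> q" by (simp add: p_def q_def oct_comp_left len)
  ultimately show "null_pair (p, q)" using q0 pure ne \<open>c \<noteq> 0\<close> by (simp add: p_def pure_scaleR)
  show z: "(a, b) \<otimes>\<^sub>B (p, q) = 0"
    unfolding bioct_mult_eq_0_iff by (simp add: aq bq p_def oct_bilinear)
  have pp: "oct_pure p" using pure by (simp add: p_def pure_scaleR)
  have "q \<otimes>\<^sub>O a = (a \<bullet> a) *\<^sub>R (b \<otimes>\<^sub>O c)" "q \<otimes>\<^sub>O b = - ((a \<bullet> a) *\<^sub>R (a \<otimes>\<^sub>O c))"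
    using a_q b_q unfolding pure_mult_commute[OF q0 pure(1)] pure_mult_commute[OF q0 pure(2)]
    by (simp_all add: aq bq inner_commute)
  then show "(a, b) \<otimes>\<^sub>S (p, q) = 0"
    unfolding sed_mult_pure[OF pp q0] pair_eq_0_iff by (simp add: p_def oct_bilinear)
qed

text \<open>Fewer linear conditions than dimensions always leave a nonzero solution. The conditions
  are given as a list, so that their number is evident even when some of them coincide.\<close>
lemma exists_orthogonal_to_list:
  fixes ys :: "'a::euclidean_space list"
  assumes "length ys < DIM('a)"
  obtains c where "c \<noteq> 0" "list_all (\<lambda>y. c \<bullet> y = 0) ys"
proof -
  have "dim (set ys) < DIM('a)"
    using dim_le_card'[of "set ys"] card_length[of ys] assms by simp
  then obtain c where "c \<noteq> 0" "\<And>y. y \<in> span (set ys) \<Longrightarrow> orthogonal c y"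
    using orthogonal_to_subspace_exists by blast
  then show thesis using that by (simp add: orthogonal_def span_base list_all_iff)
qed

lemma null_pair_annihilator_exists:
  assumes "null_pair (a, b)"
  obtains p q where "null_pair (p, q)" "(a, b) \<otimes>\<^sub>B (p, q) = 0"
    "a \<bullet> q = 0" "b \<bullet> q = 0" "(a, b) \<otimes>\<^sub>S (p, q) = 0"
proof -
  obtain c where c0: "c \<noteq> 0" and "list_all (\<lambda>y. c \<bullet> y = 0) [oct_one, a, b, a \<otimes>\<^sub>O b]"
    by (rule exists_orthogonal_to_list[of "[oct_one, a, b, a \<otimes>\<^sub>O b]"]) simp
  then have c: "c \<bullet> oct_one = 0" "c \<bullet> a = 0" "c \<bullet> b = 0" "c \<bullet> (a \<otimes>\<^sub>O b) = 0"
    by simp_all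
  show thesis by (rule that[OF annihilator_of_null_pair[OF assms c0 c]])
qed

text \<open>Let \<open>P = a + ib\<close> and \<open>Q = c + id\<close>. Since \<open>PQ = 0\<close>, all complex combinations of \<open>P\<close> and \<open>Q\<close> are
  null with pairwise vanishing products. Half the Hermitian product of \<open>P\<close> and \<open>Q\<close> is \<open>g1 + i g2\<close>,
  and half the squared norm of \<open>P\<close> is \<open>a \<bullet> a\<close>, so that \<open>R = r1 + i r2\<close>, which is
  \<open>(a \<bullet> a) Q - (g1 + i g2) P\<close>, is the Gram-Schmidt component of \<open>Q\<close> orthogonal to \<open>P\<close>. Its
  Hermitian product with \<open>P\<close> is zero, and with \<open>Q\<close> it is real, as for every orthogonal
  projection. If \<open>R\<close> is zero, then \<open>Q\<close> is a complex multiple of \<open>P\<close>, and whatever annihilates \<open>P\<close>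
  and is orthogonal to \<open>P\<close> has the same relation to \<open>Q\<close>.\<close>
lemma real_collinear_midpoint:
  assumes P: "null_pair (a, b)" and Q: "null_pair (c, d)" and PQ: "(a, b) \<otimes>\<^sub>B (c, d) = 0"
  obtains r1 r2 where "null_pair (r1, r2)" "real_collinear (a, b) (r1, r2)"
    "real_collinear (r1, r2) (c, d)"
proof -
  note p = null_pairD[OF P] and q = null_pairD[OF Q]
  note z = bioct_mult_0D[OF PQ]
  define g1 g2 where "g1 = a \<bullet> c" and "g2 = a \<bullet> d"
  have bd: "b \<bullet> d = g1" and bc: "b \<bullet> c = - g2"
    using bioct_mult_0_inner[OF p(1,2) PQ] by (simp_all add: g1_def g2_def)
  note inn = bd bc g1_def[symmetric] g2_def[symmetric]
    bd[unfolded inner_commute[of b]] bc[unfolded inner_commute[of b]]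
    g1_def[symmetric, unfolded inner_commute[of a]] g2_def[symmetric, unfolded inner_commute[of a]]
  define r1 where "r1 = (a \<bullet> a) *\<^sub>R c - g1 *\<^sub>R a + g2 *\<^sub>R b"
  define r2 where "r2 = (a \<bullet> a) *\<^sub>R d - g1 *\<^sub>R b - g2 *\<^sub>R a"
  have norm: "r1 \<bullet> r1 = r2 \<bullet> r2" and orth: "r1 \<bullet> r2 = 0"
    unfolding r1_def r2_def
    by (simp_all add: inner_simps p q inn algebra_simps)
  show thesis
  proof (cases "r1 = 0")
    case False
    have "oct_pure r1" "oct_pure r2"
      unfolding r1_def r2_def by (intro pure_add pure_diff pure_scaleR p q)+
    then have R: "null_pair (r1, r2)" using False norm orth by simp
    have 1: "(a, b) \<otimes>\<^sub>B (r1, r2) = 0"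
      unfolding bioct_mult_eq_0_iff r1_def r2_def
      by (simp add: oct_bilinear z pure_self_mult p null_pair_anticommute[OF P])
    have 2: "(r1, r2) \<otimes>\<^sub>B (c, d) = 0"
      unfolding bioct_mult_eq_0_iff r1_def r2_def
      by (simp add: oct_bilinear z pure_self_mult q null_pair_anticommute[OF Q])
    have "a \<bullet> r2 = 0" "r1 \<bullet> d = 0"
      unfolding r1_def r2_def by (simp_all add: inner_simps p q inn)
    with 1 2 show thesis by (intro that[OF R] real_collinearI)
  next
    case True
    with norm have r: "r1 = 0" "r2 = 0" by simp_all
    \<comment> \<open>\<open>Q\<close> is the multiple of \<open>P\<close> by the complex number \<open>s + i t\<close>.\<close>
    define s t where "s = g1 / (a \<bullet> a)" and "t = g2 / (a \<bullet> a)"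
    have ne: "a \<bullet> a \<noteq> 0" using p by simp
    have "(a \<bullet> a) *\<^sub>R c = (a \<bullet> a) *\<^sub>R (s *\<^sub>R a - t *\<^sub>R b)"
      "(a \<bullet> a) *\<^sub>R d = (a \<bullet> a) *\<^sub>R (s *\<^sub>R b + t *\<^sub>R a)"
      using r ne by (simp_all add: r1_def r2_def s_def t_def algebra_simps)
    then have cd: "c = s *\<^sub>R a - t *\<^sub>R b" "d = s *\<^sub>R b + t *\<^sub>R a"
      using ne by (simp_all only: scaleR_cancel_left) simp_all
    obtain x y where X: "null_pair (x, y)" "(a, b) \<otimes>\<^sub>B (x, y) = 0"
      and i: "a \<bullet> y = 0" "b \<bullet> y = 0"
      by (rule null_pair_annihilator_exists[OF P])
    note zx = bioct_mult_0D[OF X(2)]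
    have "(c, d) \<otimes>\<^sub>B (x, y) = 0"
      unfolding bioct_mult_eq_0_iff cd by (simp add: oct_bilinear zx)
    moreover have "c \<bullet> y = 0" unfolding cd by (simp add: inner_simps i)
    ultimately have "real_collinear (c, d) (x, y)" by (rule real_collinearI)
    then have "real_collinear (x, y) (c, d)" by (rule real_collinear_sym[OF Q X(1)])
    with X(1) real_collinearI[OF X(2) i(1)] show thesis by (rule that)
  qed
qed

text \<open>The product of two null vectors that are orthogonal for the complex bilinear form lies on a
  common line of the hexagon with each of them, unless it vanishes: \<open>P(PV) = P\<^sup>2V = 0\<close> and
  \<open>(PV)V = PV\<^sup>2 = 0\<close>. Orthogonality makes the product imaginary, and it is null since the complex
  norm form is multiplicative.\<close>
lemma bioct_mult_null_pair:
  assumes P: "null_pair (p, q)" and V: "null_pair (v, w)"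
    and i: "p \<bullet> v = q \<bullet> w" "p \<bullet> w = - (q \<bullet> v)" and ne: "(p, q) \<otimes>\<^sub>B (v, w) \<noteq> 0"
  shows "null_pair ((p, q) \<otimes>\<^sub>B (v, w))"
    and "(p, q) \<otimes>\<^sub>B ((p, q) \<otimes>\<^sub>B (v, w)) = 0"
    and "((p, q) \<otimes>\<^sub>B (v, w)) \<otimes>\<^sub>B (v, w) = 0"
proof -
  note p = null_pairD[OF P] and v = null_pairD[OF V]
  define x y where "x = p \<otimes>\<^sub>O v - q \<otimes>\<^sub>O w" and "y = p \<otimes>\<^sub>O w + q \<otimes>\<^sub>O v"
  have xy: "(p, q) \<otimes>\<^sub>B (v, w) = (x, y)" by (simp add: x_def y_def)
  have pure: "oct_pure x" "oct_pure y"
    unfolding x_def y_def oct_pure_def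
    using i by (simp_all add: inner_simps pure_mult_Re p v)
  have orth: "x \<bullet> y = 0"
    unfolding x_def y_def
    by (simp add: inner_simps oct_comp_left oct_comp_right p v
        inner_commute[of "q \<otimes>\<^sub>O w" "p \<otimes>\<^sub>O w"])
  have "(p \<otimes>\<^sub>O v) \<bullet> (q \<otimes>\<^sub>O w) + (q \<otimes>\<^sub>O v) \<bullet> (p \<otimes>\<^sub>O w) = 0"
    using oct_comp_polar[of p v q w] by (simp add: p)
  then have len: "x \<bullet> x = y \<bullet> y"
    unfolding x_def y_def
    by (simp add: inner_simps oct_comp_left p v inner_commute[of "q \<otimes>\<^sub>O w" "p \<otimes>\<^sub>O v"]
        inner_commute[of "p \<otimes>\<^sub>O w" "q \<otimes>\<^sub>O v"])
  have "x \<noteq> 0" using ne len unfolding xy pair_eq_0_iff by auto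
  then show "null_pair ((p, q) \<otimes>\<^sub>B (v, w))" unfolding xy using pure orth len by simp
  have sl: "q \<otimes>\<^sub>O (p \<otimes>\<^sub>O u) = - (p \<otimes>\<^sub>O (q \<otimes>\<^sub>O u))" for u
    using pure_left_swap[OF p(2,1), of u] p by simp
  have sr: "(u \<otimes>\<^sub>O w) \<otimes>\<^sub>O v = - ((u \<otimes>\<^sub>O v) \<otimes>\<^sub>O w)" for u
    using pure_right_swap[OF v(2,1), of u] v by simp
  show "(p, q) \<otimes>\<^sub>B ((p, q) \<otimes>\<^sub>B (v, w)) = 0"
    unfolding xy bioct_mult_eq_0_iff x_def y_def
    by (simp add: oct_bilinear pure_left_square p sl)
  show "((p, q) \<otimes>\<^sub>B (v, w)) \<otimes>\<^sub>B (v, w) = 0"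
    unfolding xy bioct_mult_eq_0_iff x_def y_def
    by (simp add: oct_bilinear pure_right_square v sr)
qed

text \<open>The two long entries of the list below are the conditions that \<open>p + iq\<close> is orthogonal to
  \<open>v + iw\<close> for the bilinear form, with \<open>q = a \<otimes>\<^sub>O (b \<otimes>\<^sub>O c)\<close> moved to the other side by
  adjunction. The entry \<open>w \<otimes>\<^sub>O v\<close> makes the Hermitian product of \<open>PV\<close> and \<open>V\<close> real: the relevant
  term \<open>(p \<otimes>\<^sub>O v) \<bullet> w\<close> is \<open>- p \<bullet> (w \<otimes>\<^sub>O v)\<close>. If \<open>PV\<close> vanishes, then \<open>P\<close> and \<open>V\<close> are already
  collinear, and \<open>V\<close> takes the place of \<open>Q\<close>.\<close>
lemma real_collinear_path:
  assumes U: "null_pair (a, b)" and V: "null_pair (v, w)"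
  obtains p q r1 r2 x y where "null_pair (p, q)" "null_pair (r1, r2)" "null_pair (x, y)"
    "real_collinear (a, b) (p, q)" "real_collinear (p, q) (r1, r2)"
    "real_collinear (r1, r2) (x, y)" "(x, y) = (v, w) \<or> real_collinear (x, y) (v, w)"
proof -
  note u = null_pairD[OF U] and v = null_pairD[OF V]
  let ?ys = "[oct_one, a, b, a \<otimes>\<^sub>O b, w \<otimes>\<^sub>O v,
    (a \<bullet> a) *\<^sub>R v - b \<otimes>\<^sub>O (a \<otimes>\<^sub>O w), (a \<bullet> a) *\<^sub>R w + b \<otimes>\<^sub>O (a \<otimes>\<^sub>O v)]"
  obtain c where c0: "c \<noteq> 0" and "list_all (\<lambda>y. c \<bullet> y = 0) ?ys"
    by (rule exists_orthogonal_to_list[of ?ys]) simp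
  then have c: "c \<bullet> oct_one = 0" "c \<bullet> a = 0" "c \<bullet> b = 0" "c \<bullet> (a \<otimes>\<^sub>O b) = 0" "c \<bullet> (w \<otimes>\<^sub>O v) = 0"
    "c \<bullet> ((a \<bullet> a) *\<^sub>R v - b \<otimes>\<^sub>O (a \<otimes>\<^sub>O w)) = 0" "c \<bullet> ((a \<bullet> a) *\<^sub>R w + b \<otimes>\<^sub>O (a \<otimes>\<^sub>O v)) = 0"
    by simp_all
  define p q where "p = (a \<bullet> a) *\<^sub>R c" and "q = a \<otimes>\<^sub>O (b \<otimes>\<^sub>O c)"
  note P = annihilator_of_null_pair(1,2,3)[OF U c0 c(1-4), folded p_def q_def]
  have adj: "q \<bullet> e = c \<bullet> (b \<otimes>\<^sub>O (a \<otimes>\<^sub>O e))" for e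
    unfolding q_def by (simp add: pure_left_adjoint u)
  have i: "p \<bullet> v = q \<bullet> w" "p \<bullet> w = - (q \<bullet> v)"
    using c(6,7) unfolding adj by (simp_all add: p_def inner_simps)
  show thesis
  proof (cases "(p, q) \<otimes>\<^sub>B (v, w) = 0")
    case True
    from P(1) V True obtain r1 r2 where "null_pair (r1, r2)" "real_collinear (p, q) (r1, r2)"
      "real_collinear (r1, r2) (v, w)" by (rule real_collinear_midpoint)
    then show thesis
      by (rule that[OF P(1) _ V real_collinearI[OF P(2,3)] _ _ disjI1[OF refl]])
  next
    case False
    obtain x y where xy: "(p, q) \<otimes>\<^sub>B (v, w) = (x, y)" by (rule prod.exhaust)
    note Q = bioct_mult_null_pair[OF P(1) V i False, unfolded xy]
    from P(1) Q(1,2) obtain r1 r2 where R: "null_pair (r1, r2)" "real_collinear (p, q) (r1, r2)"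
      "real_collinear (r1, r2) (x, y)" by (rule real_collinear_midpoint)
    have "(p \<otimes>\<^sub>O v) \<bullet> w = 0"
      using c(5) by (simp add: p_def oct_bilinear pure_right_adjoint v)
    moreover have "(q \<otimes>\<^sub>O w) \<bullet> w = 0"
      using oct_comp_right[of q w oct_one] null_pairD(2)[OF P(1)]
      by (simp add: oct_one_mult oct_pure_def)
    moreover have "x = p \<otimes>\<^sub>O v - q \<otimes>\<^sub>O w" using xy by simp
    ultimately have "x \<bullet> w = 0" by (simp add: inner_simps)
    with Q(3) have "real_collinear (x, y) (v, w)" by (rule real_collinearI)
    then show thesis
      by (intro that[OF P(1) R(1) Q(1) real_collinearI[OF P(2,3)] R(2,3)] disjI2)
  qed
qed

section \<open>Zero divisors of the sedenions\<close>

lemma conj3_norm: "conj3 x \<bullet> conj3 x = x \<bullet> x"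
  by (cases x) (auto simp: oct_coords)

lemma conj3_mult: "conj3 (x \<otimes>\<^sub>O y) = conj3 y \<otimes>\<^sub>O conj3 x"
proof -
  have "\<And>x y. conj3 (x \<otimes>\<^sub>O y) = conj3 y \<otimes>\<^sub>O conj3 x"
    unfolding split_paired_all by (simp add: oct_coords algebra_simps)
  then show ?thesis .
qed

lemma conj3_conj3: "conj3 (conj3 x) = x"
  by (cases x) (auto simp: oct_coords)

lemma conj3_diff: "conj3 (x - y) = conj3 x - conj3 y"
  by (simp add: oct_conj_eq inner_diff_left algebra_simps)

lemma conj3_add: "conj3 (x + y) = conj3 x + conj3 y"
  by (simp add: oct_conj_eq inner_add_left algebra_simps)

lemma conj3_minus: "conj3 (- x) = - conj3 x"
  by (simp add: oct_conj_eq)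

lemma conj4_pair: "conj4 (a, b) = (conj3 a, - b)"
  by (simp add: conj4_def cd_conj_def)

lemma conj4_mult: "conj4 (x \<otimes>\<^sub>S y) = conj4 y \<otimes>\<^sub>S conj4 x"
proof -
  obtain a b where x: "x = (a, b)" by (rule prod.exhaust)
  obtain c d where y: "y = (c, d)" by (rule prod.exhaust)
  show ?thesis
    unfolding x y by (simp add: sed_mult_pair conj4_pair conj3_mult conj3_conj3 conj3_diff
        conj3_minus oct.minus_left oct.minus_right)
qed

lemma conj4_eq_0_iff: "conj4 x = 0 \<longleftrightarrow> x = 0"
proof -
  obtain a b where x: "x = (a, b)" by (rule prod.exhaust)
  have "conj3 a = 0 \<longleftrightarrow> a = 0" using conj3_norm[of a] by (metis inner_eq_zero_iff)
  then show ?thesis unfolding x conj4_pair pair_eq_0_iff by simp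
qed

text \<open>The vanishing product gives \<open>ac = d\<^sup>*b\<close> and \<open>da = - bc\<^sup>*\<close>, where a star denotes conjugation.
  Each of the three properties of \<open>(a, b)\<close> is obtained by computing a quantity, multiplied by
  \<open>c \<bullet> c\<close> and by \<open>d \<bullet> d\<close>, from these two equations and adding the results: norms give
  \<open>a \<bullet> a = b \<bullet> b\<close>; pairing the first equation with \<open>d\<^sup>*\<close> and the second one with \<open>c\<^sup>*\<close> gives the real
  part of \<open>b\<close>; pairing them with \<open>bc\<close> and \<open>db\<close> gives \<open>a \<bullet> b\<close>.\<close>
lemma annihilated_imp_null_pair:
  assumes a: "oct_pure a" and u: "(a, b) \<noteq> 0" and v: "(c, d) \<noteq> 0"
    and uv: "(a, b) \<otimes>\<^sub>S (c, d) = 0"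
  shows "null_pair (a, b)"
proof -
  have 1: "a \<otimes>\<^sub>O c = conj3 d \<otimes>\<^sub>O b" and 2: "d \<otimes>\<^sub>O a = - (b \<otimes>\<^sub>O conj3 c)"
    using uv unfolding sed_mult_pair pair_eq_0_iff by (simp_all add: eq_neg_iff_add_eq_0)
  define m where "m = c \<bullet> c + d \<bullet> d"
  have "m > 0" using v unfolding m_def pair_eq_0_iff
    by (metis add_nonneg_pos add_pos_nonneg inner_ge_zero inner_gt_zero_iff)
  have "(a \<otimes>\<^sub>O c) \<bullet> (a \<otimes>\<^sub>O c) = (conj3 d \<otimes>\<^sub>O b) \<bullet> (conj3 d \<otimes>\<^sub>O b)" by (simp only: 1)
  moreover have "(d \<otimes>\<^sub>O a) \<bullet> (d \<otimes>\<^sub>O a) = (b \<otimes>\<^sub>O conj3 c) \<bullet> (b \<otimes>\<^sub>O conj3 c)" by (simp add: 2)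
  ultimately have "m * (a \<bullet> a) = m * (b \<bullet> b)"
    by (simp add: oct_comp_left conj3_norm m_def algebra_simps)
  with \<open>m > 0\<close> have len: "a \<bullet> a = b \<bullet> b" by simp
  have "(d \<bullet> d) * (b \<bullet> oct_one) = (conj3 d \<otimes>\<^sub>O b) \<bullet> conj3 d"
    using oct_comp_left[of "conj3 d" b oct_one] by (simp add: oct_mult_one conj3_norm)
  also have "\<dots> = a \<bullet> (conj3 d \<otimes>\<^sub>O conj3 c)" by (simp only: 1[symmetric] oct_right_adjoint)
  also have "\<dots> = (d \<otimes>\<^sub>O a) \<bullet> conj3 c" by (simp only: oct_left_adjoint)
  also have "\<dots> = - ((c \<bullet> c) * (b \<bullet> oct_one))"
    using oct_comp_right[of b "conj3 c" oct_one] by (simp add: 2 oct_one_mult conj3_norm)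
  finally have "m * (b \<bullet> oct_one) = 0" by (simp add: m_def algebra_simps)
  with \<open>m > 0\<close> have b: "oct_pure b" by (simp add: oct_pure_def)
  have A: "(c \<bullet> c) * (a \<bullet> b) = 2 * (d \<bullet> oct_one) * (b \<bullet> (b \<otimes>\<^sub>O c)) - (d \<otimes>\<^sub>O b) \<bullet> (b \<otimes>\<^sub>O c)"
  proof -
    have "(c \<bullet> c) * (a \<bullet> b) = (conj3 d \<otimes>\<^sub>O b) \<bullet> (b \<otimes>\<^sub>O c)"
      by (simp only: 1[symmetric] oct_comp_right)
    then show ?thesis by (simp add: oct_conj_eq oct_bilinear oct_one_mult inner_simps)
  qed
  have B: "(d \<bullet> d) * (a \<bullet> b) = (b \<otimes>\<^sub>O c) \<bullet> (d \<otimes>\<^sub>O b) - 2 * (c \<bullet> oct_one) * (b \<bullet> (d \<otimes>\<^sub>O b))"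
  proof -
    have "(d \<bullet> d) * (a \<bullet> b) = - ((b \<otimes>\<^sub>O conj3 c) \<bullet> (d \<otimes>\<^sub>O b))"
      by (simp only: oct_comp_left[symmetric] 2 inner_minus_left)
    then show ?thesis by (simp add: oct_conj_eq oct_bilinear oct_mult_one inner_simps)
  qed
  have "b \<bullet> (b \<otimes>\<^sub>O c) = (b \<bullet> b) * (c \<bullet> oct_one)" "b \<bullet> (d \<otimes>\<^sub>O b) = (b \<bullet> b) * (d \<bullet> oct_one)"
    using oct_comp_left[of b oct_one c] oct_comp_right[of oct_one b d]
    by (simp_all add: oct_mult_one oct_one_mult inner_commute)
  with A B have "m * (a \<bullet> b) = 0"
    unfolding m_def distrib_right by (simp add: inner_commute)
  with \<open>m > 0\<close> have "a \<bullet> b = 0" by simp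
  moreover have "a \<noteq> 0" using u len unfolding pair_eq_0_iff by auto
  ultimately show ?thesis using a b len by simp
qed

text \<open>Conjugation is an antiautomorphism and sends \<open>(a, b)\<close> to \<open>- (a, b)\<close> because \<open>a\<close> is imaginary.
  So an element that annihilates \<open>(a, b)\<close> from the left has a conjugate that annihilates it from
  the right.\<close>
lemma zero_divisor_imp_null_pair:
  assumes "oct_pure a" "(a, b) \<in> sed_zero_divisors"
  shows "null_pair (a, b)"
proof -
  obtain v where u: "(a, b) \<noteq> 0" and v: "v \<noteq> 0" and
    uv: "(a, b) \<otimes>\<^sub>S v = 0 \<or> v \<otimes>\<^sub>S (a, b) = 0"
    using assms(2) unfolding sed_zero_divisors_def by blast
  have "\<exists>w. w \<noteq> 0 \<and> (a, b) \<otimes>\<^sub>S w = 0"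
  proof (cases "(a, b) \<otimes>\<^sub>S v = 0")
    case False
    with uv have "conj4 (v \<otimes>\<^sub>S (a, b)) = 0" by (simp only: conj4_eq_0_iff simp_thms)
    moreover have "conj4 (a, b) = (- 1) *\<^sub>R (a, b)" by (simp add: conj4_pair pure_conj assms(1))
    ultimately have "(- 1) *\<^sub>R ((a, b) \<otimes>\<^sub>S conj4 v) = 0"
      by (simp only: conj4_mult sed_mult_scaleR_left)
    then have "(a, b) \<otimes>\<^sub>S conj4 v = 0" by (simp only: scaleR_eq_0_iff) simp
    with v show ?thesis using conj4_eq_0_iff by blast
  qed (use v in blast)
  then obtain w where w: "w \<noteq> 0" "(a, b) \<otimes>\<^sub>S w = 0" by blast
  show ?thesis
    using annihilated_imp_null_pair[OF assms(1) u, of "fst w" "snd w"] w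
    by (simp only: prod.collapse simp_thms)
qed

lemma null_pair_imp_zero_divisor:
  assumes "null_pair (a, b)"
  shows "(a, b) \<in> sed_zero_divisors"
proof -
  obtain p q where "null_pair (p, q)" and z: "(a, b) \<otimes>\<^sub>S (p, q) = 0"
    by (rule null_pair_annihilator_exists[OF assms])
  then have "(p, q) \<noteq> 0" "(a, b) \<noteq> 0"
    unfolding pair_eq_0_iff using null_pairD(3) assms by blast+
  with z show ?thesis unfolding sed_zero_divisors_def by blast
qed

lemma sed_Im_pair: "sed_Im (a, b) = (a - (a \<bullet> oct_one) *\<^sub>R oct_one, b)"
proof -
  have "(b + b) /\<^sub>R 2 = b" by (simp flip: scaleR_2)
  moreover have "(a - conj3 a) /\<^sub>R 2 = a - (a \<bullet> oct_one) *\<^sub>R oct_one"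
    by (simp add: oct_conj_eq algebra_simps flip: scaleR_2)
  ultimately show ?thesis by (simp add: sed_Im_def conj4_pair)
qed

lemma sed_Im_null_pair: "null_pair (a, b) \<Longrightarrow> sed_Im (a, b) = (a, b)"
  unfolding sed_Im_pair by (simp add: oct_pure_def)

lemma null_pair_in_Reals_plus_Z: "null_pair (a, b) \<Longrightarrow> (a, b) \<in> sed_Reals_plus_Z"
  by (simp only: sed_Reals_plus_Z_def mem_Collect_eq sed_Im_null_pair null_pair_imp_zero_divisor)

lemma Reals_plus_Z_Im:
  assumes "x \<in> sed_Reals_plus_Z"
  obtains a b where "sed_Im x = (a, b)" "null_pair (a, b)"
proof -
  obtain a b where x: "x = (a, b)" by (rule prod.exhaust)
  let ?a = "a - (a \<bullet> oct_one) *\<^sub>R oct_one"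
  have "oct_one \<bullet> oct_one = 1" by (simp add: oct_one_def zero_prod_def)
  then have "oct_pure ?a" by (simp add: oct_pure_def inner_diff_left)
  moreover have "(?a, b) \<in> sed_zero_divisors"
    using assms unfolding sed_Reals_plus_Z_def x mem_Collect_eq sed_Im_pair .
  ultimately show thesis using that[OF sed_Im_pair[of a b, folded x]] zero_divisor_imp_null_pair
    by blast
qed

lemma sed_mult_add_left: "(x + y) \<otimes>\<^sub>S z = x \<otimes>\<^sub>S z + y \<otimes>\<^sub>S z"
  and sed_mult_add_right: "z \<otimes>\<^sub>S (x + y) = z \<otimes>\<^sub>S x + z \<otimes>\<^sub>S y"
proof -
  obtain a b where x: "x = (a, b)" by (rule prod.exhaust)
  obtain c d where y: "y = (c, d)" by (rule prod.exhaust)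
  obtain e f where z: "z = (e, f)" by (rule prod.exhaust)
  show "(x + y) \<otimes>\<^sub>S z = x \<otimes>\<^sub>S z + y \<otimes>\<^sub>S z" "z \<otimes>\<^sub>S (x + y) = z \<otimes>\<^sub>S x + z \<otimes>\<^sub>S y"
    unfolding x y z by (simp_all add: sed_mult_pair conj3_add oct.add_left oct.add_right)
qed

lemma commute_if_Im_commute:
  assumes "sed_Im x \<otimes>\<^sub>S sed_Im y = sed_Im y \<otimes>\<^sub>S sed_Im x"
  shows "x \<otimes>\<^sub>S y = y \<otimes>\<^sub>S x"
proof -
  have *: "\<exists>r. x = r *\<^sub>R sed_one + sed_Im x" for x
  proof -
    obtain a b where x: "x = (a, b)" by (rule prod.exhaust)
    have one: "sed_one = (oct_one, 0)" by (simp add: sed_one_def oct_one_def)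
    show ?thesis unfolding x sed_Im_pair one by (intro exI[of _ "a \<bullet> oct_one"]) simp
  qed
  obtain r s where "x = r *\<^sub>R sed_one + sed_Im x" "y = s *\<^sub>R sed_one + sed_Im y"
    using * by meson
  then obtain u v where "x = r *\<^sub>R sed_one + u" "y = s *\<^sub>R sed_one + v" "u \<otimes>\<^sub>S v = v \<otimes>\<^sub>S u"
    using assms by blast
  then show ?thesis
    by (simp add: sed_mult_add_left sed_mult_add_right sed_mult_scaleR_left sed_mult_scaleR_right
        sed_one_left sed_one_right scaleR_add_right add_ac mult.commute[of s r])
qed

section \<open>Short paths in the commutativity graph\<close>

text \<open>The last step of \<open>real_collinear_path\<close> may be an equality instead of collinearity, which also
  implies commutation.\<close>
lemma Reals_plus_Z_commuting_path:
  assumes "x \<in> sed_Reals_plus_Z" "y \<in> sed_Reals_plus_Z"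
  obtains p r q where "p \<in> sed_Reals_plus_Z" "r \<in> sed_Reals_plus_Z" "q \<in> sed_Reals_plus_Z"
    "x \<otimes>\<^sub>S p = p \<otimes>\<^sub>S x" "p \<otimes>\<^sub>S r = r \<otimes>\<^sub>S p" "r \<otimes>\<^sub>S q = q \<otimes>\<^sub>S r" "q \<otimes>\<^sub>S y = y \<otimes>\<^sub>S q"
proof -
  obtain a b where x: "sed_Im x = (a, b)" "null_pair (a, b)" by (rule Reals_plus_Z_Im[OF assms(1)])
  obtain v w where y: "sed_Im y = (v, w)" "null_pair (v, w)" by (rule Reals_plus_Z_Im[OF assms(2)])
  obtain p p' r r' q q' where n: "null_pair (p, p')" "null_pair (r, r')" "null_pair (q, q')"
    and c: "real_collinear (a, b) (p, p')" "real_collinear (p, p') (r, r')"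
      "real_collinear (r, r') (q, q')" "(q, q') = (v, w) \<or> real_collinear (q, q') (v, w)"
    by (rule real_collinear_path[OF x(2) y(2)])
  note comm = real_collinear_imp_commute
  have qv: "(q, q') \<otimes>\<^sub>S (v, w) = (v, w) \<otimes>\<^sub>S (q, q')"
    using c(4)
  proof
    assume "(q, q') = (v, w)"
    then show ?thesis by (simp only:)
  qed (rule comm[OF n(3) y(2)])
  have qy: "(q, q') \<otimes>\<^sub>S y = y \<otimes>\<^sub>S (q, q')"
    by (rule commute_if_Im_commute) (simp only: sed_Im_null_pair n y(1) qv)
  have xp: "x \<otimes>\<^sub>S (p, p') = (p, p') \<otimes>\<^sub>S x"
    by (rule commute_if_Im_commute)
      (simp only: sed_Im_null_pair n x(1) comm[OF x(2) n(1) c(1)])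
  show thesis
    by (rule that[OF n[THEN null_pair_in_Reals_plus_Z] xp
        comm[OF n(1,2) c(2)] comm[OF n(2,3) c(3)] qy])
qed

lemma Reals_plus_Z_nonempty: "sed_Reals_plus_Z \<noteq> {}"
proof -
  have "null_pair ((((0, 1), 0), 0), (((0, 0), (1, 0)), 0))"
    by (simp add: oct_pure_def oct_one_def zero_prod_def)
  then show ?thesis using null_pair_in_Reals_plus_Z by blast
qed

interpretation Z: wf_digraph sed_comm_graph_Z
  using induced_sed_comm_graph_Z by (auto simp: induced_subgraph_def subgraph_def)

lemma verts_sed_comm_graph_Z: "verts sed_comm_graph_Z = sed_line ` sed_Reals_plus_Z"
  by (simp add: sed_comm_graph_Z_def)

text \<open>Commuting elements may span the same line. The walk is then empty, since the graph has no
  loops.\<close>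
lemma commuting_imp_step:
  assumes "x \<in> sed_Reals_plus_Z" "y \<in> sed_Reals_plus_Z" "x \<otimes>\<^sub>S y = y \<otimes>\<^sub>S x"
  obtains p where "Z.awalk (sed_line x) p (sed_line y)" "length p \<le> 1"
proof (cases "sed_line x = sed_line y")
  case True
  have "Z.awalk (sed_line x) [] (sed_line y)"
    using True assms by (simp add: Z.awalk_Nil_iff verts_sed_comm_graph_Z)
  then show thesis by (rule that) simp
next
  case False
  let ?e = "(sed_line x, sed_line y)"
  have "?e \<in> parcs sed_comm_graph"
    using assms False sed_Reals_plus_Z_nonreal by (subst sed_comm_graph_adj_iff) auto
  then have "?e \<in> arcs sed_comm_graph_Z"
    using assms by (simp add: sed_comm_graph_Z_def)
  then have "Z.awalk (tail sed_comm_graph_Z ?e) [?e] (head sed_comm_graph_Z ?e)"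
    by (rule Z.arc_implies_awalk)
  then have "Z.awalk (sed_line x) [?e] (sed_line y)" by (simp add: sed_comm_graph_Z_def)
  then show thesis by (rule that) simp
qed

lemma short_walk:
  assumes "u \<in> verts sed_comm_graph_Z" "v \<in> verts sed_comm_graph_Z"
  obtains p where "Z.awalk u p v" "length p \<le> 4"
proof -
  obtain x y where x: "x \<in> sed_Reals_plus_Z" "u = sed_line x"
    and y: "y \<in> sed_Reals_plus_Z" "v = sed_line y"
    using assms unfolding verts_sed_comm_graph_Z by blast
  obtain p r q where z: "p \<in> sed_Reals_plus_Z" "r \<in> sed_Reals_plus_Z" "q \<in> sed_Reals_plus_Z"
    and c: "x \<otimes>\<^sub>S p = p \<otimes>\<^sub>S x" "p \<otimes>\<^sub>S r = r \<otimes>\<^sub>S p" "r \<otimes>\<^sub>S q = q \<otimes>\<^sub>S r" "q \<otimes>\<^sub>S y = y \<otimes>\<^sub>S q"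
    by (rule Reals_plus_Z_commuting_path[OF x(1) y(1)])
  obtain w1 where 1: "Z.awalk u w1 (sed_line p)" "length w1 \<le> 1"
    using commuting_imp_step[OF x(1) z(1) c(1)] x(2) by blast
  obtain w2 where 2: "Z.awalk (sed_line p) w2 (sed_line r)" "length w2 \<le> 1"
    by (rule commuting_imp_step[OF z(1,2) c(2)])
  obtain w3 where 3: "Z.awalk (sed_line r) w3 (sed_line q)" "length w3 \<le> 1"
    by (rule commuting_imp_step[OF z(2,3) c(3)])
  obtain w4 where 4: "Z.awalk (sed_line q) w4 v" "length w4 \<le> 1"
    using commuting_imp_step[OF z(3) y(1) c(4)] y(2) by blast
  have "Z.awalk u (w1 @ w2 @ w3 @ w4) v"
    by (intro Z.awalk_appendI[OF 1(1)] Z.awalk_appendI[OF 2(1)] Z.awalk_appendI[OF 3(1)] 4(1))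
  then show thesis by (rule that) (use 1 2 3 4 in simp)
qed

theorem proposition6p6:
  shows "Digraph_Component.connected sed_comm_graph_Z \<and> diameter sed_comm_graph_Z \<le> 4"
proof
  show "Digraph_Component.connected sed_comm_graph_Z"
  proof (rule Z.connectedI)
    show "verts sed_comm_graph_Z \<noteq> {}"
      by (simp add: verts_sed_comm_graph_Z Reals_plus_Z_nonempty)
    fix u v assume "u \<in> verts sed_comm_graph_Z" "v \<in> verts sed_comm_graph_Z"
    then obtain p where "Z.awalk u p v" using short_walk by blast
    then show "u \<rightarrow>\<^sup>*\<^bsub>mk_symmetric sed_comm_graph_Z\<^esub> v"
      by (intro Z.reachable_mk_symmetricI Z.reachable_awalkI)
  qed
  have "Z.\<mu> (\<lambda>_. 1) u v \<le> 4"
    if uv: "u \<in> verts sed_comm_graph_Z" "v \<in> verts sed_comm_graph_Z" for u v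
  proof -
    obtain p where p: "Z.awalk u p v" "length p \<le> 4" using short_walk[OF uv] .
    have "Z.awalk_cost (\<lambda>_. 1) p = real (length p)" by (simp add: Z.awalk_cost_def sum_list_triv)
    then show ?thesis
      using Z.min_cost_le_walk_cost[OF p(1), of "\<lambda>_. 1"] p(2) by (simp add: order_trans)
  qed
  then show "diameter sed_comm_graph_Z \<le> 4"
    unfolding diameter_def by (intro SUP_least)
qed

end
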